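(* Let $m,n\in\mathbb{N}$ with $m>n$. The function \[ F(x)=(x+1)\left(\frac{x+m-n+1}{(x+m+1)^2}-\frac{x+n-m+1}{(x+n+1)^2}\right) \] is a monotonically decreasing function of the real variable $x\in[m-n,\infty)$ if and only if \[ (1+m)^3(m+n-mn+2m^2-n^2)<(2m+1-n)^3(m+n-mn+m^2). \] If $F$ is not monotonically decreasing on $[m-n,\infty)$, then it has a unique critical point in this interval, where $F$ attains a local maximum.
   Context: $\mathbb{N}$ denotes the positive integers. *)

theory Defs
  imports Complex_Main
begin

definition F :: "nat \<Rightarrow> nat \<Rightarrow> real \<Rightarrow> real" where
  "F m n x = (x + 1) *
     ((x + real m - real n + 1) / (x + real m + 1)^2 - (x + real n - real m + 1) / (x + real n + 1)^2)"

(* Derivative and neighbourhood are two-sided also at the left end point m - n of the interval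
   on which F m n is studied; F m n is smooth in a neighbourhood of that interval. *)
definition critical_point :: "(real \<Rightarrow> real) \<Rightarrow> real \<Rightarrow> bool" where
  "critical_point f x \<longleftrightarrow> (f has_real_derivative 0) (at x)"

definition local_maximum :: "(real \<Rightarrow> real) \<Rightarrow> real \<Rightarrow> bool" where
  "local_maximum f x \<longleftrightarrow> (\<forall>\<^sub>F y in nhds x. f y \<le> f x)"

end

theory Submission
  imports Defs "HOL-Computational_Algebra.Nth_Powers"
begin

text \<open>
  Put \<open>y = x + 1\<close> and \<open>d = m - n\<close>. Each of the two quotients in \<open>F\<close> has a derivative with
  denominator \<open>(y + m)^3\<close> or \<open>(y + n)^3\<close>, and over a common denominator the terms of degree 4
  cancel: the derivative of \<open>F\<close> is \<open>d * K(y) / ((y + m)^3 (y + n)^3)\<close> for a cubic \<open>K\<close>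
  (\<open>slope_factor\<close>) whose nonconstant coefficients are all nonpositive, the leading one being
  negative. Hence \<open>K\<close> is strictly decreasing for \<open>y \<ge> 0\<close>, and the derivative changes sign at
  most once, from plus to minus. So \<open>F\<close> is antimonotone from \<open>x = d\<close> on iff \<open>K(d + 1) \<le> 0\<close>;
  otherwise the zero of \<open>K\<close> is the only critical point, and a maximum.

  The two sides of the integer inequality differ by \<open>d * K(d + 1)\<close>, so the inequality says
  \<open>K(d + 1) < 0\<close>. Strict and weak inequality agree only if \<open>K(d + 1) = 0\<close> has no solution in
  integers \<open>m > n \<ge> 1\<close>, and this is the arithmetic core of the theorem
  (\<open>boundary_equality_impossible\<close>). Let \<open>A = 2 m + 1 - n\<close> and \<open>B = m + 1\<close>, the values of
  \<open>y + m\<close> and \<open>y + n\<close> at the end point. In these coordinates the curve \<open>K(d + 1) = 0\<close> is a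
  quartic with a double point at the origin: its equation has only terms of degree 4, 3 and 2.
  On a line through the origin it therefore becomes a quadratic equation, which can have an
  integral solution only if its discriminant is a square. The discriminant factors
  as \<open>(A^2 + B^2) (A^4 + B^4)\<close>.

  After removing the common factor of \<open>A\<close> and \<open>B\<close>, the two factors are coprime up to a
  factor 2, so \<open>A^4 + B^4\<close> is a square or twice a square. The first is excluded by
  Fermat's descent (\<open>no_sum_of_fourth_powers_square\<close>). In the second, half the sum and half the
  difference of \<open>A^2\<close> and \<open>B^2\<close> are numbers \<open>u\<close> and \<open>t\<close> for which \<open>u^2 + t^2\<close> and \<open>u^2 - t^2\<close> are
  both squares, and the classical descent for congruent numbers
  (\<open>no_square_plus_minus_square\<close>) forces \<open>t = 0\<close>, that is \<open>A = B\<close>. But \<open>A - B = m - n > 0\<close>.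
\<close>

section \<open>Coprime factors of squares and Pythagorean triples\<close>

lemma coprime_factor_of_square:
  fixes a b c :: nat
  assumes "coprime a b" and "a * b = c^2"
  obtains x where "a = x^2"
proof -
  have "is_nth_power 2 (a * b)" using assms(2) by auto
  then have "is_nth_power 2 a"
    using assms(1) is_nth_power_mult_coprime_nat_iff by blast
  then show ?thesis using that by (auto elim!: is_nth_powerE)
qed

lemma coprime_factors_of_square:
  fixes a b c :: nat
  assumes "coprime a b" and "a * b = c^2"
  obtains x y where "a = x^2" and "b = y^2" and "coprime x y"
proof -
  obtain x where x: "a = x^2" using coprime_factor_of_square assms by blast
  obtain y where y: "b = y^2"
    using coprime_factor_of_square[of b a c] assms by (auto simp: coprime_commute mult.commute)
  show ?thesis using that[OF x y] assms(1) x y by simp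
qed

text \<open>Since \<open>p\<close> is odd, the factor 2 joins \<open>q\<close>: with \<open>q = 2 j\<close> and \<open>t = 2 k\<close> one has
  \<open>p * j = k^2\<close> for coprime \<open>p\<close> and \<open>j\<close>.\<close>

lemma coprime_factors_of_double_square:
  fixes p q t :: nat
  assumes "coprime p q" and "odd p" and "2 * p * q = t^2"
  obtains r s where "p = r^2" and "q = 2 * s^2"
proof -
  have "even t" using assms(3) by (metis dvd_triv_left even_mult_iff even_power)
  then obtain k where k: "t = 2 * k" by blast
  have pq: "p * q = 2 * k^2" using assms(3) k by (simp add: power2_eq_square)
  then have "even q" using assms(2) by (metis dvd_triv_left even_mult_iff)
  then obtain j where j: "q = 2 * j" by blast
  have "coprime p j" using assms(1) j by simp
  moreover have "p * j = k^2" using pq j by simp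
  ultimately obtain r s where "p = r^2" "j = s^2" using coprime_factors_of_square by blast
  then show ?thesis using that j by blast
qed

lemma coprime_difference_and_sum:
  fixes u v :: nat
  assumes "coprime u v" and "odd (u + v)" and "v \<le> u"
  shows "coprime (u + v) (u - v)"
proof (rule coprimeI)
  fix c assume c: "c dvd u + v" "c dvd u - v"
  have "(u + v) + (u - v) = 2 * u" "(u + v) - (u - v) = 2 * v" using assms(3) by auto
  then have "c dvd 2 * u" "c dvd 2 * v"
    using c by (metis dvd_add, metis dvd_diff_nat)
  moreover have "odd c" using c(1) assms(2) dvd_trans by blast
  then have "coprime c 2" by simp
  ultimately have "c dvd u" "c dvd v" by (auto simp: coprime_dvd_mult_right_iff)
  then show "is_unit c" using assms(1) coprime_common_divisor by blast
qed

text \<open>Two odd squares add up to 2 modulo 4, which is not a square.\<close>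

lemma pythagorean_parity:
  fixes x y z :: nat
  assumes "coprime x y" and "x^2 + y^2 = z^2"
  shows "even x \<longleftrightarrow> odd y"
proof -
  have "\<not> (even x \<and> even y)" using assms(1) by auto
  moreover have False if xy: "odd x" "odd y"
  proof -
    obtain a b where "x = 2 * a + 1" "y = 2 * b + 1" using xy by (auto elim!: oddE)
    moreover have "even z" using assms(2) xy by (metis even_add even_power odd_add)
    then obtain c where "z = 2 * c" by blast
    ultimately have "4 * (a^2 + a + b^2 + b) + 2 = 4 * c^2"
      using assms(2) by (simp add: power2_eq_square algebra_simps)
    then show False by presburger
  qed
  ultimately show ?thesis by blast
qed

text \<open>Write \<open>z = x + 2 v\<close>. Then \<open>(x + v) * v = (y / 2)^2\<close> with coprime factors, which are hence
  squares \<open>p^2\<close> and \<open>q^2\<close>. The equation \<open>x = p^2 - q^2\<close> is stated with \<open>q^2\<close> moved to the left,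
  because in the descents below \<open>x\<close> is itself a square and this is then a Pythagorean
  triple again.\<close>

lemma pythagorean_parametrization:
  fixes x y z :: nat
  assumes cop: "coprime x y" and eq: "x^2 + y^2 = z^2" and ev: "even y" and pos: "y > 0"
  obtains p q where "coprime p q" and "q > 0" and "x + q^2 = p^2" and "y = 2 * p * q" and "z = p^2 + q^2"
proof -
  have oddx: "odd x" using cop ev by auto
  have oddz: "odd z" using eq oddx ev by (metis even_add even_power zero_less_numeral)
  have "x \<le> z" using eq by (metis le_add1 power2_nat_le_eq_le)
  moreover have "even (z - x)" using oddx oddz by simp
  ultimately obtain v where v: "z = x + 2 * v" by (metis dvdE le_add_diff_inverse)
  obtain k where k: "y = 2 * k" using ev by blast
  have prod: "(x + v) * v = k^2"
    using eq v k by (simp add: power2_eq_square algebra_simps)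
  have "coprime (x^2) (y^2)" using cop by simp
  then have "coprime (x^2) (z^2)"
    unfolding eq[symmetric] by (simp only: coprime_iff_gcd_eq_1 gcd_add2)
  then have "coprime x z" by simp
  have "coprime (x + v) v"
  proof (rule coprimeI)
    fix c assume "c dvd x + v" "c dvd v"
    then have "c dvd x" "c dvd z" using v by (auto simp: dvd_add_left_iff)
    then show "is_unit c" using \<open>coprime x z\<close> coprime_common_divisor by blast
  qed
  then obtain p q where pq: "x + v = p^2" "v = q^2" "coprime p q"
    using coprime_factors_of_square prod by blast
  have "k^2 = (p * q)^2" using prod pq by (metis power_mult_distrib)
  then have "k = p * q" by simp
  then show ?thesis using that[OF pq(3)] pq v k pos by auto
qed

section \<open>Two infinite descents\<close>

text \<open>Infinite descent on \<open>u\<close>. Averaging the roots gives \<open>v = X + Y\<close>, \<open>w = X - Y\<close> with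
  \<open>X^2 + Y^2 = u^2\<close> and \<open>2 X Y = t^2\<close>, so \<open>X\<close> and \<open>Y\<close> are \<open>r^2\<close> and \<open>2 s^2\<close> in some order. The
  parameters \<open>p\<close>, \<open>q\<close> of the triple \<open>r^2\<close>, \<open>2 s^2\<close>, \<open>u\<close> have product \<open>s^2\<close>, so they are squares
  \<open>e^2\<close>, \<open>f^2\<close>, and \<open>r^2 = p^2 - q^2 = (e^2 + f^2) (e^2 - f^2)\<close> splits into two coprime squares:
  \<open>e\<close>, \<open>f\<close> is a smaller solution.\<close>

lemma no_square_plus_minus_square:
  fixes u t v w :: nat
  assumes "coprime u t" and "t > 0" and "u^2 + t^2 = v^2" and "w^2 + t^2 = u^2"
  shows False
  using assms
proof (induction u arbitrary: t v w rule: less_induct)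
  case (less u)
  have vw: "v^2 = w^2 + 2 * t^2" using less.prems by simp
  then have "even v \<longleftrightarrow> even w" by (metis dvd_triv_left even_add even_power zero_less_numeral)
  moreover have "w \<le> v" using vw by (metis le_add1 power2_nat_le_eq_le)
  ultimately have "even (v - w)" by simp
  then obtain Y where Y: "v = w + 2 * Y" using \<open>w \<le> v\<close> by (metis dvdE le_add_diff_inverse)
  define X where "X = w + Y"
  have t: "2 * X * Y = t^2" using vw unfolding Y X_def by (simp add: power2_eq_square algebra_simps)
  have u: "X^2 + Y^2 = u^2"
    using less.prems(4) t unfolding X_def by (simp add: power2_eq_square algebra_simps)
  have cop: "coprime X Y"
  proof (rule coprimeI)
    fix c assume "c dvd X" "c dvd Y"
    then have "c dvd u^2" "c dvd t^2"
      unfolding u[symmetric] t[symmetric] by (auto simp: power2_eq_square)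
    moreover have "coprime (u^2) (t^2)" using less.prems(1) by simp
    ultimately show "is_unit c" using coprime_common_divisor by blast
  qed
  have XY: "X > 0" "Y > 0" using t less.prems(2) by (auto intro!: Nat.gr0I)
  have par: "even X \<longleftrightarrow> odd Y" using pythagorean_parity cop u .
  obtain r s where rs: "odd r" "coprime (r^2) (2 * s^2)" "(r^2)^2 + (2 * s^2)^2 = u^2" "2 * s^2 > 0"
  proof (cases "odd X")
    case True
    then obtain r s where "X = r^2" "Y = 2 * s^2"
      using coprime_factors_of_double_square[OF cop _ t] by blast
    then show ?thesis using that[of r s] True cop u XY by auto
  next
    case False
    moreover have "2 * Y * X = t^2" using t by (simp add: ac_simps)
    moreover have "coprime Y X" using cop by (simp add: coprime_commute)
    ultimately obtain r s where "Y = r^2" "X = 2 * s^2"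
      using coprime_factors_of_double_square par by blast
    then show ?thesis using that[of r s] False par cop u XY
      by (auto simp: coprime_commute add.commute)
  qed
  obtain p q where pq: "coprime p q" "q > 0" "r^2 + q^2 = p^2" "2 * s^2 = 2 * p * q" "u = p^2 + q^2"
    using pythagorean_parametrization[OF rs(2,3) _ rs(4)] by (metis dvd_triv_left)
  have "p * q = s^2" using pq(4) by simp
  then obtain e f where ef: "p = e^2" "q = f^2" "coprime e f"
    using coprime_factors_of_square pq(1) by blast
  have le: "f^2 \<le> e^2" using pq(3) ef by (metis le_add2 power2_nat_le_eq_le)
  have prod: "(e^2 + f^2) * (e^2 - f^2) = r^2"
  proof -
    obtain d where d: "e^2 = f^2 + d" using le le_Suc_ex by blast
    have "r^2 + (f^2)^2 = (f^2 + d)^2" using pq(3) ef(1,2) d by simp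
    then show ?thesis unfolding d by (simp add: power2_eq_square algebra_simps)
  qed
  have "coprime (e^2 + f^2) (e^2 - f^2)"
  proof (rule coprime_difference_and_sum)
    show "coprime (e^2) (f^2)" using ef(3) by simp
    have "odd ((e^2 + f^2) * (e^2 - f^2))" unfolding prod using rs(1) by simp
    then show "odd (e^2 + f^2)" by simp
  qed (fact le)
  then obtain v' w' where "e^2 + f^2 = v'^2" "e^2 - f^2 = w'^2"
    using coprime_factors_of_square prod by blast
  moreover from this le have "w'^2 + f^2 = e^2" by (metis le_add_diff_inverse2)
  moreover have "f > 0" using ef(2) pq(2) by (auto intro: Nat.gr0I)
  moreover have "e < u"
  proof -
    have "e \<le> p" "p \<le> p^2" unfolding ef(1) by (simp_all add: power2_nat_le_imp_le self_le_power power2_eq_square)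
    then have "e \<le> p^2" by (rule order_trans)
    moreover have "0 < q^2" using pq(2) by simp
    ultimately show ?thesis using pq(5) by linarith
  qed
  ultimately show False using less.IH[of e f v' w'] ef(3) by simp
qed

text \<open>Infinite descent on \<open>z\<close>. With \<open>y\<close> even, the parameters \<open>p\<close>, \<open>q\<close> of the triple \<open>x^2\<close>, \<open>y^2\<close>,
  \<open>z\<close> satisfy \<open>y^2 = 2 p q\<close>, so that \<open>p = r^2\<close> and \<open>q = 2 s^2\<close>. The parameters of the second
  triple \<open>x\<close>, \<open>q\<close>, \<open>p\<close> have product \<open>s^2\<close>, so they are squares \<open>e^2\<close>, \<open>f^2\<close>, and
  \<open>e^4 + f^4 = p = r^2\<close> with \<open>r < z\<close>.\<close>

lemma no_sum_of_fourth_powers_square: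
  fixes x y z :: nat
  assumes "coprime x y" and "x > 0" and "y > 0" and "x^4 + y^4 = z^2"
  shows False
  using assms
proof (induction z arbitrary: x y rule: less_induct)
  case (less z)
  have descent: False
    if cop: "coprime x y" and xy: "x > 0" "y > 0" "even y" and eq: "x^4 + y^4 = z^2" for x y :: nat
  proof -
    have eq2: "(x^2)^2 + (y^2)^2 = z^2" using eq by (simp flip: power_mult)
    obtain p q where pq: "coprime p q" "q > 0" "x^2 + q^2 = p^2" "y^2 = 2 * p * q" "z = p^2 + q^2"
      using pythagorean_parametrization[OF _ eq2] cop xy by auto
    have "coprime (x^2 + q^2) (q^2)" unfolding pq(3) using pq(1) by simp
    then have "coprime (x^2) (q^2)" by (simp only: coprime_iff_gcd_eq_1 gcd_add1)
    then have xq: "coprime x q" by simp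
    have "odd x" using cop xy(3) by auto
    then have "even q" using pythagorean_parity[OF xq pq(3)] by blast
    then have "odd p" using pq(1) by auto
    then obtain r s where rs: "p = r^2" "q = 2 * s^2"
      using coprime_factors_of_double_square[OF pq(1) _ pq(4)[symmetric]] by blast
    obtain g h where gh: "coprime g h" "h > 0" "q = 2 * g * h" "p = g^2 + h^2"
      using pythagorean_parametrization[OF xq pq(3) \<open>even q\<close> pq(2)] by metis
    have "g * h = s^2" using gh(3) rs(2) by simp
    then obtain e f where ef: "g = e^2" "h = f^2" "coprime e f"
      using coprime_factors_of_square gh(1) by blast
    have "e^4 + f^4 = r^2" using gh(4) rs(1) ef by (simp flip: power_mult)
    moreover have "e > 0" "f > 0" using ef gh pq(2) by (auto intro!: Nat.gr0I)
    moreover have "r < z"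
    proof -
      have "r \<le> p" "p \<le> p^2" unfolding rs(1) by (simp_all add: self_le_power power2_eq_square)
      then have "r \<le> p^2" by (rule order_trans)
    moreover have "0 < q^2" using pq(2) by simp
    ultimately show ?thesis using pq(5) by linarith
    qed
    ultimately show False using less.IH ef(3) by blast
  qed
  have "coprime (x^2) (y^2)" "(x^2)^2 + (y^2)^2 = z^2" using less.prems by (simp_all flip: power_mult)
  then have "even (x^2) \<longleftrightarrow> odd (y^2)" by (rule pythagorean_parity)
  then show False
    using descent[of x y] descent[of y x] less.prems by (auto simp: coprime_commute add.commute)
qed

section \<open>No integer solutions on the boundary\<close>

lemma odd_common_divisor_of_sums_of_powers:
  fixes a b c :: nat
  assumes "coprime a b" and "odd c" and "c dvd a^2 + b^2" and "c dvd a^4 + b^4"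
  shows "c = 1"
proof -
  have *: "c dvd 2 * y^4" if "c dvd x^2 + y^2" "c dvd x^4 + y^4" for x y :: nat
  proof -
    \<comment> \<open>\<open>(x^4 + y^4) - (x^2 + y^2) (x^2 - y^2) = 2 y^4\<close>; over the integers, as \<open>x < y\<close> may hold\<close>
    have "int c dvd int (x^4 + y^4) - int (x^2 + y^2) * (int x^2 - int y^2)"
      using that by (intro dvd_diff dvd_mult2) (simp_all only: int_dvd_int_iff)
    also have "\<dots> = int (2 * y^4)" by (simp add: power2_eq_square power4_eq_xxxx algebra_simps)
    finally show ?thesis by (simp only: int_dvd_int_iff)
  qed
  have "c dvd 2 * a^4" "c dvd 2 * b^4"
    using *[of b a] *[of a b] assms(3,4) by (simp_all add: add.commute)
  moreover have "coprime c 2" using assms(2) by simp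
  ultimately have "c dvd a^4" "c dvd b^4" by (auto simp: coprime_dvd_mult_right_iff)
  moreover have "coprime (a^4) (b^4)" using assms(1) by simp
  ultimately show ?thesis using coprime_common_divisor_nat by blast
qed

text \<open>For \<open>u = (a^2 + b^2) / 2\<close> and \<open>t = (a^2 - b^2) / 2\<close> both \<open>u^2 + t^2 = (a^4 + b^4) / 2\<close> and
  \<open>u^2 - t^2 = (a b)^2\<close> are squares.\<close>

lemma sum_of_fourth_powers_twice_square:
  fixes a b v :: nat
  assumes "coprime a b" "odd a" "odd b" "a^4 + b^4 = 2 * v^2"
  shows "a = b"
proof (rule ccontr)
  assume "a \<noteq> b"
  have *: False if ab: "coprime a b" "odd a" "odd b" "a^4 + b^4 = 2 * v^2" "b < a" for a b :: nat
  proof -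
    have "b^2 < a^2" using ab(5) by (simp add: power_strict_mono)
    moreover have "even (a^2 - b^2)" using ab by simp
    ultimately obtain t where t: "a^2 = b^2 + 2 * t" by (metis dvdE le_add_diff_inverse less_imp_le)
    define u where "u = b^2 + t"
    have "2 * (u^2 + t^2) = (a^2)^2 + (b^2)^2"
      unfolding t u_def by (simp add: power2_eq_square algebra_simps)
    then have "u^2 + t^2 = v^2" using ab(4) by (simp flip: power_mult)
    moreover have "(a * b)^2 + t^2 = u^2"
      unfolding power_mult_distrib t u_def by (simp add: power2_eq_square algebra_simps)
    moreover have "t > 0" using t \<open>b^2 < a^2\<close> by simp
    moreover have "coprime u t"
    proof (rule coprimeI)
      fix c assume "c dvd u" "c dvd t"
      then have "c dvd b^2" "c dvd a^2" unfolding t u_def by (auto simp: dvd_add_left_iff)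
      moreover have "coprime (a^2) (b^2)" using ab(1) by simp
      ultimately show "is_unit c" using coprime_common_divisor by blast
    qed
    ultimately show False using no_square_plus_minus_square by blast
  qed
  show False using *[of a b] *[of b a] \<open>a \<noteq> b\<close> assms
    by (auto simp: coprime_commute add.commute neq_iff)
qed

text \<open>The positive rational points on the genus 2 curve \<open>w^2 = (r^2 + 1) (r^4 + 1)\<close> are
  those with \<open>r = 1\<close>. For coprime \<open>a\<close>, \<open>b\<close> the two factors have no common odd divisor. If \<open>a\<close> and
  \<open>b\<close> have different parity, both factors are odd, hence squares. If both are odd, then
  \<open>(a^2 + b^2) / 2\<close> is odd and the halves of the factors are squares.\<close>

lemma product_of_sums_of_powers_square:
  fixes A B w :: nat
  assumes pos: "A > 0" "B > 0" and eq: "(A^2 + B^2) * (A^4 + B^4) = w^2"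
  shows "A = B"
proof -
  define g where "g = gcd A B"
  obtain a b where ab: "A = g * a" "B = g * b" "coprime a b" 
    unfolding g_def using gcd_coprime_exists[of A B] pos by (metis gcd_pos_nat mult.commute neq0_conv)
  have g: "g > 0" using pos g_def by simp
  have eq2: "(g^3)^2 * ((a^2 + b^2) * (a^4 + b^4)) = w^2"
    unfolding eq[symmetric] ab by (simp add: power_mult_distrib algebra_simps flip: power_mult power_add)
  then have "(g^3)^2 dvd w^2" by (metis dvd_triv_left)
  then have "g^3 dvd w" by (subst (asm) pow_divides_pow_iff) simp_all
  then obtain k where k: "w = g^3 * k" by blast
  have prod: "(a^2 + b^2) * (a^4 + b^4) = k^2"
    using eq2 g unfolding k power_mult_distrib[of "g^3"] by simp
  have ab0: "a > 0" "b > 0" using pos ab by (auto intro!: Nat.gr0I)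
  show "A = B"
  proof (cases "odd a \<and> odd b")
    case True
    then obtain i j where ij: "a = 2 * i + 1" "b = 2 * j + 1" by (auto elim!: oddE)
    \<comment> \<open>half of \<open>a^2 + b^2\<close>, in a form that shows that it is odd\<close>
    define S where "S = 2 * (i^2 + i + j^2 + j) + 1"
    have S: "a^2 + b^2 = 2 * S" unfolding ij S_def by (simp add: power2_eq_square algebra_simps)
    have "even (a^4 + b^4)" using True by simp
    then obtain T where T: "a^4 + b^4 = 2 * T" by blast
    have "even (k^2)" using prod S by (metis dvd_triv_left even_mult_iff)
    then obtain l where l: "k = 2 * l" by auto
    have "T * S = l^2" using prod unfolding S T l by (simp add: power2_eq_square ac_simps)
    moreover have "coprime T S"
    proof (rule coprimeI)
      fix c assume c: "c dvd T" "c dvd S"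
      have "odd S" unfolding S_def by simp
      then have "odd c" using c(2) dvd_trans by blast
      then show "is_unit c" using odd_common_divisor_of_sums_of_powers[OF ab(3), of c] c S T by simp
    qed
    ultimately obtain v where "T = v^2" using coprime_factor_of_square by blast
    then have "a = b" using sum_of_fourth_powers_twice_square[of a b v] ab(3) True T by simp
    then show ?thesis using ab by simp
  next
    case False
    then have "odd (a^2 + b^2)" using ab(3) by auto
    have "coprime (a^4 + b^4) (a^2 + b^2)"
    proof (rule coprimeI)
      fix c assume c: "c dvd a^4 + b^4" "c dvd a^2 + b^2"
      then have "odd c" using \<open>odd (a^2 + b^2)\<close> dvd_trans by blast
      then show "is_unit c" using odd_common_divisor_of_sums_of_powers[OF ab(3), of c] c by simp
    qed
    moreover have "(a^4 + b^4) * (a^2 + b^2) = k^2" using prod by (simp add: mult.commute)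
    ultimately obtain v where "a^4 + b^4 = v^2" using coprime_factor_of_square by blast
    then show ?thesis using no_sum_of_fourth_powers_square ab(3) ab0 by blast
  qed
qed

text \<open>In terms of \<open>A = 2 m + 1 - n\<close> and \<open>B = m + 1\<close> and after division by \<open>A - B\<close>, equality reads
  \<open>C = 2 E + 2 H\<close> with forms \<open>C\<close>, \<open>E\<close>, \<open>H\<close> of degree 4, 3 and 2. Scaling \<open>(A, B)\<close> by \<open>g\<close> turns
  this into the quadratic \<open>C g^2 - 2 E g - 2 H = 0\<close> with the root \<open>g = 1\<close>. Completing the square
  gives \<open>(C - E)^2 = E^2 + 2 C H\<close>, and the right hand side is \<open>(A^2 + B^2) (A^4 + B^4)\<close>.\<close>

lemma boundary_equality_impossible:
  fixes m n :: int
  assumes "1 \<le> n" and "n < m"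
  shows "(1 + m)^3 * (m + n - m * n + 2 * m^2 - n^2) \<noteq> (2 * m + 1 - n)^3 * (m + n - m * n + m^2)"
proof
  assume eq: "(1 + m)^3 * (m + n - m * n + 2 * m^2 - n^2) = (2 * m + 1 - n)^3 * (m + n - m * n + m^2)"
  define A where "A = 2 * m + 1 - n"
  define B where "B = m + 1"
  define C where "C = B * (A^3 + A * B^2 - 4 * B^3)"
  define E where "E = A^3 - A^2 * B - A * B^2 - 3 * B^3"
  define H where "H = A^2 + A * B + B^2"
  have m: "m = B - 1" and n: "n = 2 * B - 1 - A" by (simp_all add: A_def B_def)
  have "(A - B) * (C - 2 * E - 2 * H) = 
     (2 * m + 1 - n)^3 * (m + n - m * n + m^2) - (1 + m)^3 * (m + n - m * n + 2 * m^2 - n^2)"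
    unfolding C_def E_def H_def m n by algebra
  then have CEH: "C = 2 * E + 2 * H" using eq assms by (auto simp: A_def B_def)
  have "(C - E)^2 = E^2 + C * (C - 2 * E)" by algebra
  also have "\<dots> = E^2 + 2 * C * H" using CEH by simp
  also have "\<dots> = (A^2 + B^2) * (A^4 + B^4)" unfolding C_def E_def H_def by algebra
  finally have sq: "(A^2 + B^2) * (A^4 + B^4) = (C - E)^2" by simp
  have pos: "0 < B" "B < A" using assms by (auto simp: A_def B_def)
  obtain a b where ab: "A = int a" "B = int b" using pos zero_le_imp_eq_int by (meson less_imp_le less_trans)
  have "int ((a^2 + b^2) * (a^4 + b^4)) = int ((nat \<bar>C - E\<bar>)^2)" using sq unfolding ab by simp
  then have "(a^2 + b^2) * (a^4 + b^4) = (nat \<bar>C - E\<bar>)^2" by (simp only: of_nat_eq_iff)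
  then have "a = b" using product_of_sums_of_powers_square[of a b] pos ab by simp
  then show False using pos ab by simp
qed

section \<open>The sign of the derivative\<close>

text \<open>This is the cubic \<open>K\<close> of the introduction: the numerator of the derivative of \<open>F m n\<close> at
  \<open>x = y - 1\<close>, divided by \<open>m - n\<close>.\<close>

definition slope_factor :: "real \<Rightarrow> real \<Rightarrow> real \<Rightarrow> real" where
  "slope_factor m n y = m * n * (m^2 + n^2) - (m + n) * (m - n)^2 * y
     - 3 * (m^2 + n^2) * y^2 - 2 * (m + n) * y^3"

lemma slope_factor_strictly_decreasing:
  assumes "m > 0" "n > 0" "0 \<le> y" "y < z"
  shows "slope_factor m n z < slope_factor m n y"
proof -
  have "(m + n) * (m - n)^2 * y \<le> (m + n) * (m - n)^2 * z"
    using assms by (intro mult_left_mono) auto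
  moreover have "3 * (m^2 + n^2) * y^2 \<le> 3 * (m^2 + n^2) * z^2"
    using assms by (intro mult_left_mono power_mono) auto
  moreover have "2 * (m + n) * y^3 < 2 * (m + n) * z^3"
    using assms by (intro mult_strict_left_mono power_strict_mono) auto
  ultimately show ?thesis unfolding slope_factor_def by linarith
qed

text \<open>Both quotients in \<open>F m n\<close> are of this form: \<open>k = m\<close>, \<open>e = m - n\<close> for the first and
  \<open>k = n\<close>, \<open>e = n - m\<close> for the second. In both cases \<open>2 k - e = m + n\<close>, and this is why the terms
  of highest degree cancel in the difference of the derivatives.\<close>

lemma quotient_has_derivative:
  fixes k e x :: real
  assumes "x + 1 + k > 0"
  shows "((\<lambda>x. (x + 1) * (x + 1 + e) / (x + 1 + k)^2) has_real_derivative
     ((2 * k - e) * (x + 1) + e * k) / (x + 1 + k)^3) (at x)"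
proof -
  define a where "a = x + 1 + k"
  have a: "a \<noteq> 0" and x: "x = a - 1 - k" using assms by (auto simp: a_def)
  have "((\<lambda>x. (x + 1) * (x + 1 + e) / (x + 1 + k)^2) has_real_derivative
      ((2 * (x + 1) + e) * a^2 - (x + 1) * (x + 1 + e) * (2 * a)) / (a^2 * a^2)) (at x)"
    using a unfolding a_def
    by (auto intro!: derivative_eq_intros simp: algebra_simps)
  also have "((2 * (x + 1) + e) * a^2 - (x + 1) * (x + 1 + e) * (2 * a)) / (a^2 * a^2)
      = ((2 * k - e) * (x + 1) + e * k) / a^3"
    using a unfolding x by (simp add: divide_simps) algebra
  finally show ?thesis by (simp add: a_def)
qed

lemma F_has_derivative:
  assumes "x + 1 + real m > 0" "x + 1 + real n > 0"
  shows "(F m n has_real_derivative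
     (real m - real n) / ((x + 1 + real m)^3 * (x + 1 + real n)^3)
       * slope_factor (real m) (real n) (x + 1)) (at x)"
proof -
  define y d where "y = x + 1" and "d = real m - real n"
  have n: "real n = real m - d" by (simp add: d_def)
  have F: "F m n = (\<lambda>x. (x + 1) * (x + 1 + d) / (x + 1 + real m)^2
      - (x + 1) * (x + 1 + - d) / (x + 1 + real n)^2)"
    unfolding F_def[abs_def] d_def by (simp add: algebra_simps)
  have "(F m n has_real_derivative
      ((2 * real m - d) * y + d * real m) / (y + real m)^3
        - ((2 * real n - - d) * y + - d * real n) / (y + real n)^3) (at x)"
    unfolding F y_def by (intro DERIV_diff quotient_has_derivative assms)
  also have "((2 * real m - d) * y + d * real m) / (y + real m)^3
        - ((2 * real n - - d) * y + - d * real n) / (y + real n)^3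
      = d / ((y + real m)^3 * (y + real n)^3) * slope_factor (real m) (real n) y"
  proof -
    have "((2 * real m - d) * y + d * real m) * (y + real n)^3
        - ((2 * real n - - d) * y + - d * real n) * (y + real m)^3
        = d * slope_factor (real m) (real n) y"
      unfolding slope_factor_def n by algebra
    moreover have "y + real m \<noteq> 0" "y + real n \<noteq> 0" using assms by (auto simp: y_def)
    ultimately show ?thesis by (simp add: diff_frac_eq)
  qed
  finally show ?thesis by (simp add: y_def d_def)
qed

text \<open>The derivative is written as \<open>p x * k x\<close>, where \<open>p\<close> is positive and \<open>k\<close> is strictly decreasing,
  so its sign on the whole half-line is governed by \<open>k a\<close>: if \<open>k a > 0\<close> the function increases
  just to the right of \<open>a\<close>.\<close>

lemma antimono_on_iff_initial_slope_nonpos: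
  fixes f f' :: "real \<Rightarrow> real"
  assumes deriv: "\<And>x. a \<le> x \<Longrightarrow> (f has_real_derivative p x * k x) (at x)"
    and pos: "\<And>x. a \<le> x \<Longrightarrow> p x > 0"
    and decr: "\<And>x y. a \<le> x \<Longrightarrow> x < y \<Longrightarrow> k y < k x"
  shows "antimono_on {a..} f \<longleftrightarrow> k a \<le> 0"
proof
  assume anti: "antimono_on {a..} f"
  show "k a \<le> 0"
  proof (rule ccontr)
    assume "\<not> k a \<le> 0"
    then have "p a * k a > 0" using pos[of a] by simp
    then obtain d where d: "d > 0" "\<And>h. h > 0 \<Longrightarrow> h < d \<Longrightarrow> f a < f (a + h)"
      using DERIV_pos_inc_right[OF deriv[of a]] by auto
    have "f a < f (a + d / 2)" using d by simp
    moreover have "f (a + d / 2) \<le> f a" using anti d(1) by (auto simp: monotone_on_def)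
    ultimately show False by simp
  qed
next
  assume ka: "k a \<le> 0"
  show "antimono_on {a..} f"
  proof (rule monotone_onI)
    fix x y assume xy: "x \<in> {a..}" "y \<in> {a..}" "x \<le> y"
    have "p z * k z \<le> 0" if "x \<le> z" for z
    proof -
      have "k z \<le> 0" using decr[of a z] ka xy(1) that by (cases "z = a") auto
      then show ?thesis using pos[of z] xy(1) that by (simp add: mult_le_0_iff)
    qed
    then show "f y \<le> f x"
      using xy deriv by (intro DERIV_nonpos_imp_nonincreasing[of x y f]) (auto, meson order_trans)
  qed
qed

text \<open>The function increases from \<open>a\<close> to \<open>c\<close> and decreases after \<open>c\<close>. That \<open>c\<close> is an inner point
  makes the half-line \<open>{a<..}\<close> a neighbourhood of it, so the maximum is two-sided.\<close>

lemma unique_critical_point_is_local_maximum: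
  fixes f :: "real \<Rightarrow> real"
  assumes deriv: "\<And>x. a \<le> x \<Longrightarrow> (f has_real_derivative p x * k x) (at x)"
    and pos: "\<And>x. a \<le> x \<Longrightarrow> p x > 0"
    and decr: "\<And>x y. a \<le> x \<Longrightarrow> x < y \<Longrightarrow> k y < k x"
    and c: "a < c" "k c = 0"
  shows "critical_point f c" 
    and "\<And>y. a \<le> y \<Longrightarrow> critical_point f y \<Longrightarrow> y = c"
    and "local_maximum f c"
proof -
  show "critical_point f c" using deriv[of c] c by (simp add: critical_point_def)
  show "y = c" if y: "a \<le> y" "critical_point f y" for y
  proof -
    have "p y * k y = 0" using deriv[OF y(1)] y(2) DERIV_unique unfolding critical_point_def by blast
    then have "k y = 0" using pos[OF y(1)] by simp
    then show ?thesis using decr[of y c] decr[of c y] c y(1) by (cases y c rule: linorder_cases) auto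
  qed
  have "f y \<le> f c" if y: "a < y" for y
  proof (cases "y \<le> c")
    case True
    have "0 \<le> p z * k z" if "y \<le> z" "z \<le> c" for z
      using decr[of z c] pos[of z] c y that by (cases "z = c") auto
    then show ?thesis
      using y True deriv by (intro DERIV_nonneg_imp_nondecreasing[of y c f]) (auto, meson order_less_le_trans less_imp_le)
  next
    case False
    have "p z * k z \<le> 0" if "c \<le> z" for z
      using decr[of c z] pos[of z] c that by (cases "z = c") (auto simp: mult_le_0_iff)
    then show ?thesis
      using c False deriv by (intro DERIV_nonpos_imp_nonincreasing[of c y f]) (auto, meson order_less_le_trans less_imp_le)
  qed
  moreover have "\<forall>\<^sub>F y in nhds c. y \<in> {a<..}"
    using c(1) by (intro eventually_nhds_in_open) auto
  ultimately show "local_maximum f c"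
    unfolding local_maximum_def by (auto elim: eventually_mono)
qed

section \<open>Monotonicity and the critical point\<close>

theorem theorem1p7:
  fixes m n :: nat
  assumes "n \<ge> 1" and "m > n"
  shows "(antimono_on {real m - real n ..} (F m n) \<longleftrightarrow>
            (1 + int m)^3 * (int m + int n - int m * int n + 2 * (int m)^2 - (int n)^2)
              < (2 * int m + 1 - int n)^3 * (int m + int n - int m * int n + (int m)^2)) \<and>
         (\<not> antimono_on {real m - real n ..} (F m n) \<longrightarrow>
            (\<exists>x \<in> {real m - real n ..}.
               critical_point (F m n) x \<and>
               (\<forall>y \<in> {real m - real n ..}. critical_point (F m n) y \<longrightarrow> y = x) \<and>
               local_maximum (F m n) x))"
proof -
  let ?d = "real m - real n"
  let ?L = "(1 + int m)^3 * (int m + int n - int m * int n + 2 * (int m)^2 - (int n)^2)"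
  let ?R = "(2 * int m + 1 - int n)^3 * (int m + int n - int m * int n + (int m)^2)"
  define k where "k x = slope_factor (real m) (real n) (x + 1)" for x
  define p where "p x = ?d / ((x + 1 + real m)^3 * (x + 1 + real n)^3)" for x
  have deriv: "(F m n has_real_derivative p x * k x) (at x)" if "?d \<le> x" for x
    using F_has_derivative[of x m n] that assms by (simp add: p_def k_def)
  have pos: "p x > 0" if "?d \<le> x" for x
    using that assms by (simp add: p_def)
  have decr: "k y < k x" if "?d \<le> x" "x < y" for x y
    unfolding k_def using that assms by (intro slope_factor_strictly_decreasing) auto
  have anti: "antimono_on {?d..} (F m n) \<longleftrightarrow> k ?d \<le> 0"
    by (rule antimono_on_iff_initial_slope_nonpos[OF deriv pos decr])
  have "real_of_int (?L - ?R) = ?d * k ?d"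
    unfolding k_def slope_factor_def by simp algebra
  then have "k ?d < 0 \<longleftrightarrow> ?L < ?R" "k ?d = 0 \<longleftrightarrow> ?L = ?R"
    using assms by (smt (verit) mult_pos_neg of_int_less_0_iff mult_eq_0_iff of_int_eq_0_iff of_nat_less_iff mult_less_0_iff)+
  then have cond: "k ?d \<le> 0 \<longleftrightarrow> ?L < ?R"
    using boundary_equality_impossible[of "int n" "int m"] assms by auto
  have "\<exists>x \<in> {?d..}. critical_point (F m n) x \<and>
      (\<forall>y \<in> {?d..}. critical_point (F m n) y \<longrightarrow> y = x) \<and> local_maximum (F m n) x"
    if ka: "0 < k ?d"
  proof -
    \<comment> \<open>A point to the right where the sign has changed: at \<open>y = m\<close> the term \<open>3 (m^2 + n^2) y^2\<close>
      alone exceeds the constant term \<open>m n (m^2 + n^2)\<close>, because \<open>n < m\<close>.\<close>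
    have "k (real m - 1) \<le> 0"
    proof -
      have "real m * real n * (real m^2 + real n^2) \<le> real m * real m * (real m^2 + real n^2)"
        using assms by (intro mult_right_mono mult_left_mono) auto
      also have "\<dots> \<le> 3 * (real m^2 + real n^2) * real m^2"
        using mult_right_mono[of 1 3 "(real m^2 + real n^2) * real m^2"]
        by (simp add: power2_eq_square mult_ac)
      finally have "real m * real n * (real m^2 + real n^2) \<le> 3 * (real m^2 + real n^2) * real m^2" .
      moreover have "0 \<le> (real m + real n) * (real m - real n)^2 * real m"
        and "0 \<le> 2 * (real m + real n) * real m^3" by simp_all
      moreover have "real m - 1 + 1 = real m" by simp
      ultimately show ?thesis unfolding k_def slope_factor_def by (simp only:)
    qed
    moreover have "continuous_on {?d..real m - 1} k"
      unfolding k_def slope_factor_def by (intro continuous_intros)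
    moreover have "?d \<le> real m - 1" using assms by simp
    ultimately obtain c where c: "?d \<le> c" "k c = 0"
      using IVT2'[of k "real m - 1" 0 ?d, OF _ less_imp_le[OF ka]] by metis
    moreover have "?d < c" using c ka by (cases "c = ?d") auto
    ultimately show ?thesis
      using unique_critical_point_is_local_maximum[OF deriv pos decr \<open>?d < c\<close> c(2)] by auto
  qed
  then show ?thesis using anti cond by auto
qed

end
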